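(* Let $\alpha\in\mathbb{C}$, let $\{c_n\}_{n\ge0}$ be a sequence of complex numbers, and put $d_n=\sum_{k=0}^n\binom{n}{k}(-1)^{n-k}c_k$ for $n\ge 0$. Then the binomial transform $b_n=\sum_{k=0}^n\binom{n}{k}(-1)^kH_k(\alpha)$ of the sequence $(-1)^nH_n(\alpha)$ satisfies $b_n=\frac1n\left((1-\alpha)^n-1\right)$ for $n\ge 1$, and for every integer $n\ge 0$ $$\sum_{k=0}^n\binom{n}{k}(-1)^kH_k(\alpha)c_k=(-1)^nd_nH_n(\alpha)-\sum_{m=0}^{n-1}d_m\frac{(-1)^m}{n-m}+\sum_{m=0}^{n-1}d_m\left(\sum_{t=1}^n\frac{\binom{t}{n-m}(-1)^m(1-\alpha)^{n-m}\alpha^{t-(n-m)}}{t}\,[\alpha\ne 1]\right).$$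
   Context: For $\alpha\in\mathbb{C}$, the generalized harmonic numbers are $H_0(\alpha)=0$ and $H_k(\alpha)=\sum_{j=1}^k\frac{\alpha^j}{j}$ for $k\ge 1$. The binomial transform of a sequence $\{a_k\}$ is the sequence $n\mapsto\sum_{k=0}^n\binom{n}{k}a_k$. $[P]$ is the Iverson bracket: $1$ if $P$ is true and $0$ if $P$ is false. Conventions: $\binom{t}{n-m}=0$ when $t<n-m$, and the corresponding terms are taken to be $0$; $0^0=1$; empty sums are $0$. *)

theory Defs
  imports Complex_Main
begin

definition gen_harmonic :: "nat \<Rightarrow> complex \<Rightarrow> complex" where
  "gen_harmonic k \<alpha> = (\<Sum>j=1..k. \<alpha> ^ j / of_nat j)"

definition binomial_transform :: "(nat \<Rightarrow> complex) \<Rightarrow> nat \<Rightarrow> complex" where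
  "binomial_transform a n = (\<Sum>k=0..n. of_nat (n choose k) * a k)"

end

theory Submission imports Defs begin

text \<open>
  By binomial inversion \<open>c k = (\<Sum>m\<le>k. (k choose m) * d m)\<close>, so the coefficient of \<open>d m\<close> on the
  left-hand side is, up to the factor \<open>(-1) ^ m * (n choose m)\<close>, the \<open>p\<close>-th alternating difference
  of the generalized harmonic numbers at \<open>m\<close>, where \<open>p = n - m\<close>.  For \<open>p \<ge> 1\<close> this difference times
  \<open>p * (m + p choose p)\<close> equals \<open>(1 - \<alpha>) ^ p\<close> times the truncation after \<open>\<alpha> ^ m\<close> of the power series of
  \<open>(1 - \<alpha>) ^ (-p)\<close>, minus \<open>1\<close>; both sides obey the same recurrence in \<open>p\<close>.
  The case \<open>m = 0\<close> is the formula for \<open>b\<close>.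
\<close>

text \<open>With \<open>E\<close> the shift operator the sum is \<open>(1 - E) ^ p\<close> applied
  to \<open>h\<close> at \<open>0\<close>, so this is
  \<open>(1 - E) ^ (p + 1) = (1 - E) ^ p - (1 - E) ^ p E\<close>; concretely, Pascal's rule.\<close>

lemma alternating_binomial_sum_Suc:
  fixes h :: "nat \<Rightarrow> 'a::comm_ring_1"
  shows "(\<Sum>j\<le>Suc p. of_nat (Suc p choose j) * (-1) ^ j * h j) =
    (\<Sum>j\<le>p. of_nat (p choose j) * (-1) ^ j * h j) -
    (\<Sum>j\<le>p. of_nat (p choose j) * (-1) ^ j * h (Suc j))"
proof -
  have *: "(\<Sum>j\<le>p. of_nat (p choose j) * (-1) ^ j * h j) =
      h 0 + (\<Sum>j\<le>p. of_nat (p choose Suc j) * (-1) ^ Suc j * h (Suc j))"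
    using sum.atMost_Suc_shift[of "\<lambda>j. of_nat (p choose j) * (-1) ^ j * h j" p]
    by (simp add: binomial_eq_0)
  show ?thesis
    unfolding * by (subst sum.atMost_Suc_shift)
      (simp add: algebra_simps sum.distrib sum_negf sum_subtractf)
qed

text \<open>Truncation of \<open>(1 - x) * (1 - x) ^ (-(q + 2)) = (1 - x) ^ (-(q + 1))\<close> after
  \<open>x ^ m\<close>; the subtracted term is the truncation error.\<close>

lemma neg_binomial_partial_sum:
  fixes x :: "'a::comm_ring_1"
  shows "(1 - x) * (\<Sum>i\<le>m. of_nat (i + Suc q choose Suc q) * x ^ i) =
    (\<Sum>i\<le>m. of_nat (i + q choose q) * x ^ i) - of_nat (m + Suc q choose Suc q) * x ^ Suc m"
  by (induction m) (simp_all add: algebra_simps)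

lemma binomial_absorb_upper:
  "Suc m * (Suc m + p choose p) = (Suc m + p) * (m + p choose p)"
  using Suc_times_binomial_eq[of "m + p" m] binomial_symmetric[of m "m + p"]
    binomial_symmetric[of "Suc m" "Suc (m + p)"]
  by (simp add: mult.commute)

text \<open>Stated without denominators so that the induction step reduces to the recurrence
  \<open>neg_binomial_partial_sum\<close>.\<close>
lemma alternating_binomial_sum_gen_harmonic:
  "of_nat (Suc q * (m + Suc q choose Suc q)) *
      (\<Sum>j\<le>Suc q. of_nat (Suc q choose j) * (-1) ^ j * gen_harmonic (m + j) \<alpha>) =
    (1 - \<alpha>) ^ Suc q * (\<Sum>i\<le>m. of_nat (i + q choose q) * \<alpha> ^ i) - 1"
proof (induction q arbitrary: m)
  case 0
  \<comment> \<open>Here the difference is \<open>-(\<alpha> ^ Suc m) / Suc m\<close>, so both sides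
    equal \<open>-(\<alpha> ^ Suc m)\<close>.\<close>
  have "(1 - \<alpha>) * (\<Sum>i\<le>m. \<alpha> ^ i) = 1 - \<alpha> ^ Suc m"
    by (rule sum_gp_basic)
  then show ?case
    by (simp add: gen_harmonic_def field_simps of_nat_1[unfolded One_nat_def] del: of_nat_Suc)
next
  case (Suc q)
  define T where "T = (\<lambda>p m. \<Sum>j\<le>p. of_nat (p choose j) * (-1) ^ j * gen_harmonic (m + j) \<alpha>)"
  define G where "G = (\<lambda>q m. \<Sum>i\<le>m. of_nat (i + q choose q) * \<alpha> ^ i)"
  let ?p = "Suc q" and ?B = "\<lambda>m. of_nat (m + Suc q choose Suc q) :: complex"
  have T: "T (Suc ?p) m = T ?p m - T ?p (Suc m)"
    unfolding T_def
    by (subst alternating_binomial_sum_Suc[of ?p "\<lambda>j. gen_harmonic (m + j) \<alpha>"]) simp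
  have IH: "of_nat ?p * ?B m * T ?p m = (1 - \<alpha>) ^ ?p * G q m - 1" for m
    using Suc.IH[of m] by (simp only: T_def G_def of_nat_mult)
  have up: "of_nat (Suc m) * ?B (Suc m) = of_nat (Suc m + ?p) * ?B m"
    by (simp only: of_nat_mult[symmetric] binomial_absorb_upper)
  have "Suc m * (Suc m + q choose q) = ?p * (m + ?p choose ?p)"
    using Suc_times_binomial_add[of q m] by (simp only: add_Suc add_Suc_right add.commute)
  then have low: "of_nat (Suc m) * of_nat (Suc m + q choose q) = of_nat ?p * ?B m"
    by (simp only: of_nat_mult[symmetric])
  have C: "of_nat (Suc ?p * (m + Suc ?p choose Suc ?p)) = of_nat (Suc m + ?p) * ?B m"
    by (simp only: of_nat_mult[symmetric] Suc_times_binomial add_Suc add_Suc_right)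
  have rec: "(1 - \<alpha>) * G ?p m = G q m - ?B m * \<alpha> ^ Suc m"
    unfolding G_def by (rule neg_binomial_partial_sum)
  have GS: "G q (Suc m) = G q m + of_nat (Suc m + q choose q) * \<alpha> ^ Suc m"
    by (simp add: G_def)
  \<comment> \<open>The extra factor \<open>?p\<close> produces the left side of \<open>IH\<close>
    at \<open>m\<close> and, through \<open>up\<close>, also at \<open>Suc m\<close>; it is
    cancelled at the end.\<close>
  have "of_nat ?p * (of_nat (Suc m + ?p) * ?B m * T (Suc ?p) m) =
      of_nat (Suc m + ?p) * (of_nat ?p * ?B m * T ?p m) -
      of_nat ?p * (of_nat (Suc m + ?p) * ?B m) * T ?p (Suc m)"
    unfolding T by (simp only: algebra_simps)
  also have "\<dots> = of_nat (Suc m + ?p) * (of_nat ?p * ?B m * T ?p m) -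
      of_nat (Suc m) * (of_nat ?p * ?B (Suc m) * T ?p (Suc m))"
    unfolding up[symmetric] by (simp only: ac_simps)
  \<comment> \<open>The weights \<open>Suc m + ?p\<close> and \<open>Suc m\<close> differ by
    \<open>?p\<close>, which becomes the coefficient of both \<open>G q m\<close> and the constant
    \<open>-1\<close>.\<close>
  also have "\<dots> = (1 - \<alpha>) ^ ?p * (of_nat ?p * G q m -
      of_nat (Suc m) * of_nat (Suc m + q choose q) * \<alpha> ^ Suc m) - of_nat ?p"
    unfolding IH GS of_nat_add by (simp only: algebra_simps mult_1_left mult_1_right)
  also have "\<dots> = of_nat ?p * ((1 - \<alpha>) ^ ?p * ((1 - \<alpha>) * G ?p m) - 1)"
    unfolding low rec by (simp only: algebra_simps mult_1_left mult_1_right)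
  finally have "of_nat (Suc m + ?p) * ?B m * T (Suc ?p) m = (1 - \<alpha>) ^ ?p * ((1 - \<alpha>) * G ?p m) - 1"
    by (simp only: mult_cancel_left of_nat_eq_0_iff nat.simps simp_thms)
  then show ?case
    unfolding C T_def G_def by (simp only: power_Suc ac_simps)
qed

text \<open>The inner sum is the \<open>m\<close>-th forward difference of \<open>c\<close> at
  \<open>0\<close>, so this is Newton's expansion \<open>E ^ n = (1 + \<Delta>) ^ n\<close>, with
  \<open>E\<close> the shift and \<open>\<Delta>\<close> the forward difference.\<close>

lemma binomial_inversion:
  fixes c :: "nat \<Rightarrow> 'a::comm_ring_1"
  shows "c n = (\<Sum>m\<le>n. of_nat (n choose m) * (\<Sum>k\<le>m. of_nat (m choose k) * (-1) ^ (m - k) * c k))"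
proof -
  define D where "D = (\<lambda>c m. \<Sum>k\<le>m. of_nat (m choose k) * (-1) ^ (m - k) * (c k :: 'a))"
  have D_alt: "D c m = (-1) ^ m * (\<Sum>k\<le>m. of_nat (m choose k) * (-1) ^ k * c k)" for c m
    unfolding D_def sum_distrib_left
    by (intro sum.cong) (auto simp: minus_one_power_iff)
  \<comment> \<open>This is \<open>E = \<Delta> + 1\<close>. It drives an induction over all
    sequences, whose hypothesis is applied to the shifted one.\<close>
  have D_Suc: "D (\<lambda>k. c (Suc k)) m = D c (Suc m) + D c m" for c m
    unfolding D_alt by (subst alternating_binomial_sum_Suc) (simp add: algebra_simps)
  have "c n = (\<Sum>m\<le>n. of_nat (n choose m) * D c m)" for c
  proof (induction n arbitrary: c)
    case 0
    then show ?case by (simp add: D_def)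
  next
    case (Suc n)
    have "(\<Sum>m\<le>n. of_nat (n choose m) * D c m) =
        D c 0 + (\<Sum>m\<le>n. of_nat (n choose Suc m) * D c (Suc m))"
      using sum.atMost_Suc_shift[of "\<lambda>m. of_nat (n choose m) * D c m" n]
      by (simp add: binomial_eq_0)
    then have "(\<Sum>m\<le>n. of_nat (n choose m) * D (\<lambda>k. c (Suc k)) m) =
        (\<Sum>m\<le>Suc n. of_nat (Suc n choose m) * D c m)"
      unfolding D_Suc by (subst sum.atMost_Suc_shift) (simp add: algebra_simps sum.distrib)
    then show ?case
      using Suc.IH[of "\<lambda>k. c (Suc k)"] by simp
  qed
  then show ?thesis by (simp add: D_def)
qed

text \<open>Terms with \<open>k < m\<close> vanish; for \<open>k = m + j\<close> trinomial revision
  pulls out a factor independent of \<open>j\<close>.\<close>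

lemma alternating_sum_binomial_product:
  fixes h :: "nat \<Rightarrow> 'a::comm_ring_1"
  shows "(\<Sum>k\<le>m + p. of_nat (m + p choose k) * of_nat (k choose m) * (-1) ^ k * h k) =
    of_nat (m + p choose m) * (-1) ^ m * (\<Sum>j\<le>p. of_nat (p choose j) * (-1) ^ j * h (m + j))"
    (is "sum ?f _ = _")
proof -
  have "sum ?f {..m + p} = sum ?f {m..m + p}"
    by (rule sum.mono_neutral_right) (auto simp: binomial_eq_0)
  also have "\<dots> = (\<Sum>j\<le>p. ?f (m + j))"
    using sum.shift_bounds_cl_nat_ivl[of ?f 0 m p]
    by (simp add: atLeast0AtMost add.commute)
  also have "\<dots> = (\<Sum>j\<le>p. of_nat (m + p choose m) * (-1) ^ m * (of_nat (p choose j) * (-1) ^ j * h (m + j)))"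
  proof (rule sum.cong)
    fix j assume "j \<in> {..p}"
    then have "(m + p choose (m + j)) * (m + j choose m) = (m + p choose m) * (p choose j)"
      by (subst choose_mult) auto
    then have "(of_nat (m + p choose (m + j)) * of_nat (m + j choose m) :: 'a) =
        of_nat (m + p choose m) * of_nat (p choose j)"
      by (metis of_nat_mult)
    then show "?f (m + j) = of_nat (m + p choose m) * (-1) ^ m * (of_nat (p choose j) * (-1) ^ j * h (m + j))"
      by (simp add: power_add mult_ac)
  qed simp
  finally show ?thesis by (simp add: sum_distrib_left)
qed

text \<open>Absorption, \<open>Suc q * (t choose Suc q) = t * (t - 1 choose q)\<close> for
  \<open>t \<ge> 1\<close>, cancels the denominator \<open>t\<close>. This identifies the inner sum
  of the theorem with the truncated power series.\<close>

lemma sum_binomial_over_index: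
  fixes x :: "'a::field_char_0"
  shows "of_nat (Suc q) * (\<Sum>t=1..m + Suc q. of_nat (t choose Suc q) * x ^ (t - Suc q) / of_nat t) =
    (\<Sum>i\<le>m. of_nat (i + q choose q) * x ^ i)" (is "_ * sum ?f _ = _")
proof -
  \<comment> \<open>Indices \<open>t < Suc q\<close>, where the exponent subtraction is cut off at
    \<open>0\<close>, carry a zero binomial.\<close>
  have "sum ?f {1..m + Suc q} = sum ?f {Suc q..m + Suc q}"
    by (rule sum.mono_neutral_right) (auto simp: binomial_eq_0)
  also have "\<dots> = (\<Sum>i\<le>m. ?f (i + Suc q))"
    using sum.shift_bounds_cl_nat_ivl[of ?f 0 "Suc q" m] by (simp add: atLeast0AtMost)
  finally have "of_nat (Suc q) * sum ?f {1..m + Suc q} = (\<Sum>i\<le>m. of_nat (Suc q) * ?f (i + Suc q))"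
    by (simp only: sum_distrib_left)
  also have "\<dots> = (\<Sum>i\<le>m. of_nat (i + q choose q) * x ^ i)"
  proof (rule sum.cong)
    fix i
    have "of_nat (Suc q) * of_nat (i + Suc q choose Suc q) = (of_nat (i + Suc q) * of_nat (i + q choose q) :: 'a)"
      using Suc_times_binomial[of q "i + q"] by (metis of_nat_mult add_Suc_right)
    then have "of_nat (Suc q) * ?f (i + Suc q) =
        of_nat (i + Suc q) * of_nat (i + q choose q) * x ^ i / of_nat (i + Suc q)"
      by (simp only: times_divide_eq_right mult.assoc[symmetric] add_diff_cancel_right')
    also have "\<dots> = of_nat (i + q choose q) * x ^ i"
      by (simp only: mult.assoc) (simp del: of_nat_add of_nat_Suc)
    finally show "of_nat (Suc q) * ?f (i + Suc q) = of_nat (i + q choose q) * x ^ i" .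
  qed simp
  finally show ?thesis .
qed

text \<open>The left side is the coefficient of \<open>d m\<close> once \<open>c\<close> is expanded
  by binomial inversion.\<close>

lemma alternating_sum_binomial_product_gen_harmonic:
  assumes "m < n"
  shows "(\<Sum>k\<le>n. of_nat (n choose k) * of_nat (k choose m) * (-1) ^ k * gen_harmonic k \<alpha>) =
    (\<Sum>t=1..n. of_nat (t choose (n - m)) * (-1) ^ m * (1 - \<alpha>) ^ (n - m)
        * \<alpha> ^ (t - (n - m)) / of_nat t) - (-1) ^ m / of_nat (n - m)"
proof -
  obtain q where n: "n = m + Suc q"
    using assms less_iff_Suc_add by auto
  let ?T = "\<Sum>j\<le>Suc q. of_nat (Suc q choose j) * (-1) ^ j * gen_harmonic (m + j) \<alpha>"
  let ?R = "\<Sum>t=1..n. of_nat (t choose Suc q) * \<alpha> ^ (t - Suc q) / of_nat t"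
  have sym: "(m + Suc q choose m) = (m + Suc q choose Suc q)"
    using binomial_symmetric[of m "m + Suc q"] by simp
  \<comment> \<open>Division by \<open>s = Suc q\<close>, with \<open>g\<close> the truncated
    series, \<open>u\<close> the binomial and \<open>y\<close> the alternating difference.\<close>
  have eq: "x = z * r - 1 / s"
    if "s * u * y = z * g - 1" "s * r = g" "x = u * y" "s \<noteq> 0" for x y z r s u g :: complex
    using that by (auto simp: field_simps)
  have "of_nat (n choose m) * ?T = (1 - \<alpha>) ^ Suc q * ?R - 1 / of_nat (Suc q)"
    unfolding n sym
    by (rule eq[OF alternating_binomial_sum_gen_harmonic[unfolded of_nat_mult]
          sum_binomial_over_index refl of_nat_neq_0])
  then have "(\<Sum>k\<le>n. of_nat (n choose k) * of_nat (k choose m) * (-1) ^ k * gen_harmonic k \<alpha>) =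
      (-1) ^ m * ((1 - \<alpha>) ^ Suc q * ?R - 1 / of_nat (Suc q))"
    unfolding n alternating_sum_binomial_product[of m "Suc q" "\<lambda>k. gen_harmonic k \<alpha>"]
    by (simp only: mult.assoc mult.left_commute[of "of_nat _" "(-1) ^ m"])
  also have "\<dots> = (\<Sum>t=1..n. of_nat (t choose Suc q) * (-1) ^ m * (1 - \<alpha>) ^ Suc q
        * \<alpha> ^ (t - Suc q) / of_nat t) - (-1) ^ m / of_nat (Suc q)"
    by (simp only: right_diff_distrib sum_distrib_left times_divide_eq_right mult_1_left mult_1_right mult_ac)
  finally show ?thesis by (simp only: n add_diff_cancel_left')
qed

theorem theorem4p2:
  fixes \<alpha> :: complex and b c d :: "nat \<Rightarrow> complex"
  assumes d_eq: "\<And>n. d n = (\<Sum>k=0..n. of_nat (n choose k) * (-1) ^ (n - k) * c k)"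
    and b_eq: "\<And>n. b n = binomial_transform (\<lambda>k. (-1) ^ k * gen_harmonic k \<alpha>) n"
  shows "(\<forall>n\<ge>1. b n = 1 / of_nat n * ((1 - \<alpha>) ^ n - 1)) \<and>
    (\<forall>n. (\<Sum>k=0..n. of_nat (n choose k) * (-1) ^ k * gen_harmonic k \<alpha> * c k) =
        (-1) ^ n * d n * gen_harmonic n \<alpha>
        - (\<Sum>m<n. d m * ((-1) ^ m / of_nat (n - m)))
        + (\<Sum>m<n. d m *
            (\<Sum>t=1..n. of_nat (t choose (n - m)) * (-1) ^ m * (1 - \<alpha>) ^ (n - m)
                * \<alpha> ^ (t - (n - m)) / of_nat t * of_bool (\<alpha> \<noteq> 1))))"
proof (intro conjI allI impI)
  fix n :: nat assume "n \<ge> 1"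
  then obtain q where n: "n = Suc q" by (cases n) auto
  \<comment> \<open>At \<open>m = 0\<close> the truncated series is just \<open>1\<close>, and so is
    the binomial factor.\<close>
  have "of_nat n * b n = (1 - \<alpha>) ^ n - 1"
    using alternating_binomial_sum_gen_harmonic[of q 0 \<alpha>]
    unfolding n b_eq binomial_transform_def atLeast0AtMost
    by (simp add: mult.assoc del: of_nat_Suc sum.atMost_Suc power_Suc binomial_Suc_Suc)
  then show "b n = 1 / of_nat n * ((1 - \<alpha>) ^ n - 1)"
    using \<open>n \<ge> 1\<close> by (simp add: field_simps)
next
  fix n :: nat
  let ?S = "\<lambda>m. \<Sum>k\<le>n. of_nat (n choose k) * of_nat (k choose m) * (-1) ^ k * gen_harmonic k \<alpha>"
  let ?R = "\<lambda>m. \<Sum>t=1..n. of_nat (t choose (n - m)) * (-1) ^ m * (1 - \<alpha>) ^ (n - m)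
                * \<alpha> ^ (t - (n - m)) / of_nat t * of_bool (\<alpha> \<noteq> 1)"
  \<comment> \<open>Padding the range with zero terms up to \<open>n\<close>, independent of
    \<open>k\<close>, lets the two summations be swapped.\<close>
  have c: "c k = (\<Sum>m\<le>n. of_nat (k choose m) * d m)" if "k \<le> n" for k
  proof -
    have "c k = (\<Sum>m\<le>k. of_nat (k choose m) * d m)"
      unfolding d_eq atLeast0AtMost by (rule binomial_inversion)
    also have "\<dots> = (\<Sum>m\<le>n. of_nat (k choose m) * d m)"
      using that by (intro sum.mono_neutral_left) (auto simp: binomial_eq_0)
    finally show ?thesis .
  qed
  \<comment> \<open>The term \<open>m = n\<close> is the zeroth difference, which the formula for
    positive order does not cover.\<close>
  have top: "?S n = (-1) ^ n * gen_harmonic n \<alpha>"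
    using alternating_sum_binomial_product[of n 0 "\<lambda>k. gen_harmonic k \<alpha>"] by simp
  have below: "?S m = ?R m - (-1) ^ m / of_nat (n - m)" if "m < n" for m
  \<comment> \<open>For \<open>\<alpha> = 1\<close> the bracket removes a sum that is already zero,
    since \<open>(1 - \<alpha>) ^ (n - m) = 0\<close> when \<open>m < n\<close>.\<close>
  proof (cases "\<alpha> = 1")
    case True
    then show ?thesis
      using that alternating_sum_binomial_product_gen_harmonic[OF that, of \<alpha>] by (simp add: zero_power)
  next
    case False
    then show ?thesis
      using alternating_sum_binomial_product_gen_harmonic[OF that, of \<alpha>] by simp
  qed
  have "(\<Sum>k=0..n. of_nat (n choose k) * (-1) ^ k * gen_harmonic k \<alpha> * c k) =
      (\<Sum>k\<le>n. \<Sum>m\<le>n. d m * (of_nat (n choose k) * of_nat (k choose m) * (-1) ^ k * gen_harmonic k \<alpha>))"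
    unfolding atLeast0AtMost
    by (intro sum.cong) (auto simp: c sum_distrib_left mult_ac)
  also have "\<dots> = (\<Sum>m\<le>n. d m * ?S m)"
    by (subst sum.swap) (simp only: sum_distrib_left)
  also have "\<dots> = (\<Sum>m<n. d m * ?S m) + d n * ?S n"
    by (simp only: lessThan_Suc_atMost[symmetric] sum.lessThan_Suc)
  also have "(\<Sum>m<n. d m * ?S m) = (\<Sum>m<n. d m * ?R m) - (\<Sum>m<n. d m * ((-1) ^ m / of_nat (n - m)))"
    unfolding sum_subtractf[symmetric] right_diff_distrib[symmetric]
    by (intro sum.cong refl arg_cong2[where f = "(*)"] below) simp
  finally show "(\<Sum>k=0..n. of_nat (n choose k) * (-1) ^ k * gen_harmonic k \<alpha> * c k) =
        (-1) ^ n * d n * gen_harmonic n \<alpha>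
        - (\<Sum>m<n. d m * ((-1) ^ m / of_nat (n - m))) + (\<Sum>m<n. d m * ?R m)"
    unfolding top by (simp only: algebra_simps)
qed

end
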